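(* Let $k\ge3$, $i\in\mathbb{N}$ and $1\le b\le k-1$, and set $B=(ki)\oplus(0.b)=(ki\,.\,ki+b)$. Then, as formal power series, \[ C_B^{(k)}(y) = C_{b+ki}^{(k)}(y) = y^{b+ki}\,\bigl(H_{k-1}(y)\bigr)^{i+1}. \]
   Context: Words are over the alphabet $\mathbb{N}=\{0,1,2,\dots\}$; $(x.y)$ denotes the length-2 word with letters $x,y$; $n\oplus W$ adds $n$ to every letter of $W$. For $k\ge 2$, $\phi_k$ is the morphism of $\mathbb{N}^*$ defined for $i\in\mathbb{N}$, $0\le j\le k-1$ by $\phi_k(ki+j)=(ki)(ki+j+1)$ if $0\le j\le k-2$ and $\phi_k(ki+k-1)=ki+k$; $W_n^{(k)}=\phi_k^n(0)$. For a nonempty word $B$ (possibly a single digit), $c^{(k)}(B;n)$ is the number of (possibly overlapping) occurrences of $B$ in $W_n^{(k)}$ and $C_B^{(k)}(y)=\sum_{n\ge0}c^{(k)}(B;n)y^n$. $H_{k-1}(y)=1/(1-y-\cdots-y^{k-1})$ as a formal power series. *)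

theory Defs
  imports "HOL-Library.Sublist" "HOL-Computational_Algebra.Formal_Power_Series"
begin

definition shift_word :: "nat \<Rightarrow> nat list \<Rightarrow> nat list" (infixr "\<oplus>" 65) where
  "n \<oplus> w = map (\<lambda>x. n + x) w"

definition phi_letter :: "nat \<Rightarrow> nat \<Rightarrow> nat list" where
  "phi_letter k m =
     (let i = m div k; j = m mod k
      in if j \<le> k - 2 then [k * i, k * i + j + 1] else [k * i + k])"

definition phi :: "nat \<Rightarrow> nat list \<Rightarrow> nat list" where
  "phi k w = concat (map (phi_letter k) w)"

definition W :: "nat \<Rightarrow> nat \<Rightarrow> nat list" where
  "W k n = (phi k ^^ n) [0]"

text \<open>Occurrences are counted by their starting positions, so they may overlap; this is
  meant for nonempty \<open>B\<close>.\<close>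

definition occ :: "nat list \<Rightarrow> nat list \<Rightarrow> nat" where
  "occ B w = card {p. p < length w \<and> prefix B (drop p w)}"

text \<open>The coefficient field of the generating functions is taken to be the rationals, so that
  \<open>1 / (1 - y - \<dots>)\<close> is the library's division of formal power series (the denominator
  has constant coefficient 1).\<close>

definition C :: "nat \<Rightarrow> nat list \<Rightarrow> rat fps" where
  "C k B = Abs_fps (\<lambda>n. of_nat (occ B (W k n)))"

definition H :: "nat \<Rightarrow> rat fps" where
  "H m = 1 / (1 - (\<Sum>j=1..m. fps_X ^ j))"

lemma phi_letter_low:
  assumes "k \<ge> 2" "j \<le> k - 2"
  shows "phi_letter k (k * i + j) = [k * i, k * i + j + 1]"
proof -
  have "j < k" using assms by linarith
  then show ?thesis using assms by (simp add: phi_letter_def)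
qed

lemma phi_letter_high:
  assumes "k \<ge> 2"
  shows "phi_letter k (k * i + (k - 1)) = [k * i + k]"
proof -
  obtain l where l: "k = Suc l" "l \<ge> 1" using assms by (cases k) auto
  have "(k * i + l) div k = i" "(k * i + l) mod k = l"
    using div_mult_self2[of k l i] mod_mult_self2[of l k i] l(1)
    by (simp_all del: mult_Suc add: add.commute)
  then show ?thesis using l by (simp add: phi_letter_def Let_def)
qed

end

(* Under phi_k a letter that is not a multiple of k arises only as the second letter of the image
   of its predecessor, where the multiple of k below it comes first: so each of its occurrences
   is preceded by that multiple, and C_{ki+j} = y^j C_{ki} for j < k. The letter ki arises from
   ki, ..., ki+k-2 and, for i > 0, from ki-1, so that (1 - y - ... - y^(k-1)) C_{ki} is 1 for
   i = 0 and y^k C_{k(i-1)} for i > 0. *)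
theory Submission
  imports Defs
begin

lemma occ_Nil: "occ B [] = 0"
  by (simp add: occ_def)

text \<open>Start positions are either 0 or of the form \<open>Suc p\<close>; this split makes
  \<open>occ\<close> amenable to induction on the word.\<close>

lemma occ_Cons: "occ B (x # w) = of_bool (prefix B (x # w)) + occ B w"
proof -
  let ?S = "{p. p < length w \<and> prefix B (drop p w)}"
  have "{p. p < length (x # w) \<and> prefix B (drop p (x # w))}
      = (if prefix B (x # w) then {0} else {}) \<union> Suc ` ?S"
    by (auto simp: image_iff less_Suc_eq_0_disj)
  moreover have "card ((if prefix B (x # w) then {0} else {}) \<union> Suc ` ?S)
      = of_bool (prefix B (x # w)) + card ?S"
    by (subst card_Un_disjoint) (auto simp: card_image)
  ultimately show ?thesis
    by (simp add: occ_def)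
qed

lemma occ_singleton: "occ [c] w = count_list w c"
  by (induction w) (auto simp: occ_Nil occ_Cons)

lemma phi_Nil: "phi k [] = []"
  by (simp add: phi_def)

lemma phi_Cons: "phi k (m # w) = phi_letter k m @ phi k w"
  by (simp add: phi_def)

text \<open>Both cases of \<open>phi_letter\<close> end in \<open>Suc m\<close>, and
  \<open>j = k - 1\<close> amounts to \<open>k dvd Suc m\<close>; this form needs no decomposition
  of \<open>m\<close>.\<close>

lemma phi_letter_eq:
  assumes "k \<ge> 2"
  shows "phi_letter k m = (if k dvd Suc m then [Suc m] else [k * (m div k), Suc m])"
proof -
  define i j where "i = m div k" and "j = m mod k"
  have m: "m = k * i + j" and "j < k"
    using assms by (simp_all add: i_def j_def)
  have dvd: "k dvd Suc m \<longleftrightarrow> j = k - 1"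
  proof -
    have "k dvd Suc m \<longleftrightarrow> k dvd Suc j"
      using dvd_add_right_iff[of k "k * i" "Suc j"] by (simp add: m)
    also have "\<dots> \<longleftrightarrow> j = k - 1"
      using \<open>j < k\<close> by (auto dest: dvd_imp_le)
    finally show ?thesis .
  qed
  show ?thesis
  proof (cases "j = k - 1")
    case True
    then show ?thesis
      using phi_letter_high[OF assms, of i] dvd m assms by simp
  next
    case False
    then have "j \<le> k - 2"
      using \<open>j < k\<close> by linarith
    then show ?thesis
      using phi_letter_low[OF assms, of j i, folded m] dvd False by (simp add: i_def)
  qed
qed

lemma dvd_hd_phi:
  assumes "k \<ge> 2" "phi k w \<noteq> []"
  shows "k dvd hd (phi k w)"
  using assms by (cases w) (auto simp: phi_Nil phi_Cons phi_letter_eq)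

lemma count_list_phi_nondvd:
  assumes "k \<ge> 2" "\<not> k dvd Suc m"
  shows "count_list (phi k w) (Suc m) = count_list w m"
proof (induction w)
  case (Cons a w)
  have "k * (a div k) \<noteq> Suc m"
    using assms(2) by (metis dvd_triv_left)
  then show ?case
    using Cons assms by (auto simp: phi_Cons phi_letter_eq)
qed (simp add: phi_Nil)

text \<open>The sum collects the letters whose image starts with \<open>k * i\<close> and has a
  second letter; the last term collects the letter with successor \<open>k * i\<close>. For
  \<open>i = 0\<close> there is none, but truncated subtraction would give 0, hence the case
  distinction.\<close>

lemma count_list_phi_dvd:
  assumes "k \<ge> 2"
  shows "count_list (phi k w) (k * i)
       = (\<Sum>j<k - 1. count_list w (k * i + j)) + (if i = 0 then 0 else count_list w (k * i - 1))"
proof (induction w)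
  case (Cons m w)
  \<comment> \<open>At most one summand is nonzero, so the sum tests whether \<open>m\<close> lies
    in block \<open>i\<close> below its top letter \<open>k * i + (k - 1)\<close>.\<close>
  have "(\<Sum>j<k - 1. of_bool (m = k * i + j) :: nat) = of_bool (m div k = i \<and> \<not> k dvd Suc m)"
  proof (cases "\<exists>j<k - 1. m = k * i + j")
    case True
    then obtain j where j: "j < k - 1" "m = k * i + j" by blast
    then have "m div k = i" by simp
    moreover have "\<not> k dvd Suc m"
      using dvd_add_right_iff[of k "k * i" "Suc j"] j by (auto dest: dvd_imp_le)
    moreover have "of_bool (m = k * i + l) = (if l = j then 1 else 0 :: nat)" for l
      using j by auto
    ultimately show ?thesis
      using j(1) by simp
  next
    case False
    have "\<not> (m div k = i \<and> \<not> k dvd Suc m)"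
    proof
      assume A: "m div k = i \<and> \<not> k dvd Suc m"
      then have m: "m = k * i + m mod k"
        by (metis mult_div_mod_eq)
      have "m mod k \<noteq> k - 1"
        using A assms by (metis One_nat_def Suc_pred mod_Suc dvd_eq_mod_eq_0 less_le_trans zero_less_numeral)
      moreover have "m mod k < k"
        using assms by simp
      ultimately have "m mod k < k - 1" by linarith
      with False m show False by blast
    qed
    with False show ?thesis by auto
  qed
  moreover have count_list_Cons: "count_list (m # w) c = of_bool (m = c) + count_list w c" for c
    by simp
  ultimately have sum: "(\<Sum>j<k - 1. count_list (m # w) (k * i + j))
      = of_bool (m div k = i \<and> \<not> k dvd Suc m) + (\<Sum>j<k - 1. count_list w (k * i + j))"
    by (simp only: count_list_Cons sum.distrib)
  have "(if i = 0 then 0 else count_list (m # w) (k * i - 1))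
      = of_bool (Suc m = k * i) + (if i = 0 then 0 else count_list w (k * i - 1))"
  proof (cases i)
    case (Suc l)
    then have "k * i \<noteq> 0" using assms by simp
    then have "m = k * i - 1 \<longleftrightarrow> Suc m = k * i" by linarith
    with Suc show ?thesis by simp
  qed simp
  moreover have "count_list (phi_letter k m) (k * i)
      = of_bool (m div k = i \<and> \<not> k dvd Suc m) + of_bool (Suc m = k * i)"
  proof (cases "k dvd Suc m")
    case True
    then show ?thesis
      by (simp add: phi_letter_eq[OF assms])
  next
    case False
    then have "Suc m \<noteq> k * i"
      by (metis dvd_triv_left)
    then show ?thesis
      using False assms by (simp add: phi_letter_eq)
  qed
  ultimately show ?case
    unfolding sum phi_Cons count_list_append Cons by linarith
qed (simp add: phi_Nil)

lemma occ_pair_phi: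
  assumes k: "k \<ge> 2" and b: "1 \<le> b" "b \<le> k - 1"
  shows "occ [k * i, k * i + b] (phi k w) = count_list (phi k w) (k * i + b)"
proof (induction w)
  case (Cons m w)
  have nd: "\<not> k dvd k * i + b"
    using b k dvd_add_right_iff[of k "k * i" b] by (auto dest: dvd_imp_le)
  \<comment> \<open>Rules out a pair straddling two images: its second letter would head an image,
    and such heads are multiples of \<open>k\<close>.\<close>
  have hd: "\<not> prefix [k * i + b] (phi k w)"
    using dvd_hd_phi[OF k, of w] nd by (cases "phi k w") auto
  have ndm: "k * i + b \<noteq> k * n" "k * n \<noteq> k * i + b" for n
    using nd by (metis dvd_triv_left)+
  \<comment> \<open>Ensures that the letter preceding \<open>k * i + b\<close> within a single image
    is \<open>k * i\<close> and no other multiple of \<open>k\<close>.\<close>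
  have "m div k = i" if "Suc m = k * i + b"
  proof -
    from that b have "m = k * i + (b - 1)" "b - 1 < k" by linarith+
    then show ?thesis by simp
  qed
  then show ?case
    using Cons k nd hd ndm b by (auto simp: phi_Cons phi_letter_eq occ_Cons)
qed (simp add: phi_Nil occ_Nil)

lemma W_0: "W k 0 = [0]"
  by (simp add: W_def)

lemma W_Suc: "W k (Suc n) = phi k (W k n)"
  by (simp add: W_def)

lemma C_pair:
  assumes "k \<ge> 2" "1 \<le> b" "b \<le> k - 1"
  shows "C k [k * i, k * i + b] = C k [k * i + b]"
proof -
  \<comment> \<open>Only \<open>W k (Suc n)\<close> is given as an image under \<open>phi\<close>;
    in \<open>W k 0 = [0]\<close> both counts vanish because \<open>b\<close> is positive.\<close>
  have "occ [k * i, k * i + b] (W k n) = occ [k * i + b] (W k n)" for n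
    using assms by (cases n)
      (simp_all add: W_0 W_Suc occ_pair_phi occ_singleton occ_Cons occ_Nil)
  then show ?thesis by (simp add: C_def)
qed

text \<open>The factor \<open>fps_X\<close> records one application of \<open>phi\<close>; the
  constant coefficient is 0 because \<open>W k 0\<close> contains only the letter 0.\<close>

lemma C_nondvd:
  assumes "k \<ge> 2" "\<not> k dvd Suc m"
  shows "C k [Suc m] = fps_X * C k [m]"
proof (rule fps_ext)
  show "fps_nth (C k [Suc m]) n = fps_nth (fps_X * C k [m]) n" for n
    using assms by (cases n) (simp_all add: C_def occ_singleton W_0 W_Suc count_list_phi_nondvd)
qed

lemma C_add:
  assumes "k \<ge> 2" "j < k"
  shows "C k [k * i + j] = fps_X ^ j * C k [k * i]"
  using assms(2)
proof (induction j)
  case (Suc j)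
  have "\<not> k dvd Suc (k * i + j)"
    using Suc.prems dvd_add_right_iff[of k "k * i" "Suc j"] by (auto dest: dvd_imp_le)
  then show ?case
    using C_nondvd[OF assms(1), of "k * i + j"] Suc by (simp add: mult.assoc)
qed simp

text \<open>The summand 1 for \<open>i = 0\<close> is the initial letter of \<open>W k 0\<close>;
  the other coefficients come from \<open>count_list_phi_dvd\<close>.\<close>

lemma C_dvd:
  assumes "k \<ge> 2"
  shows "C k [k * i] = fps_X * (\<Sum>j<k - 1. C k [k * i + j])
           + (if i = 0 then 1 else fps_X * C k [k * i - 1])"
proof (rule fps_ext)
  show "fps_nth (C k [k * i]) n = fps_nth (fps_X * (\<Sum>j<k - 1. C k [k * i + j])
           + (if i = 0 then 1 else fps_X * C k [k * i - 1])) n" for n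
  proof (cases n)
    case 0
    then show ?thesis using assms by (simp add: C_def occ_singleton W_0)
  next
    case (Suc n)
    show ?thesis
      unfolding Suc C_def fps_nth_Abs_fps occ_singleton W_Suc count_list_phi_dvd[OF assms]
      by (simp add: fps_sum_nth occ_singleton)
  qed
qed

lemma C_multiple:
  assumes k: "k \<ge> 2"
  shows "C k [k * i] = fps_X ^ (k * i) * H (k - 1) ^ (i + 1)"
proof -
  let ?D = "1 - (\<Sum>j=1..k - 1. fps_X ^ j) :: rat fps"
  \<comment> \<open>A nonzero constant coefficient makes \<open>?D\<close> a unit, so the division
    in \<open>H\<close> is a true inverse.\<close>
  have "fps_nth ?D 0 = 1"
    by (simp add: fps_sum_nth)
  then have HD: "H (k - 1) * ?D = 1"
    by (simp add: H_def fps_divide_unit inverse_mult_eq_1)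
  \<comment> \<open>Inserting \<open>C_add\<close> into \<open>C_dvd\<close> gives a linear equation
    for \<open>C k [k * i]\<close> with coefficient \<open>?D\<close>, solved by multiplying with
    \<open>H (k - 1)\<close>.\<close>
  have step: "C k [k * i] = H (k - 1) * (if i = 0 then 1 else fps_X * C k [k * i - 1])" for i
  proof -
    have "fps_X * (\<Sum>j<k - 1. C k [k * i + j])
        = (\<Sum>j<k - 1. fps_X ^ Suc j) * C k [k * i]"
      using C_add[OF k, of _ i] by (simp add: sum_distrib_left sum_distrib_right mult.assoc)
    also have "(\<Sum>j<k - 1. fps_X ^ Suc j :: rat fps) = (\<Sum>j=1..k - 1. fps_X ^ j)"
      by (rule sum.reindex_bij_witness[of _ "\<lambda>j. j - 1" Suc]) auto
    finally have S: "fps_X * (\<Sum>j<k - 1. C k [k * i + j])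
        = (\<Sum>j=1..k - 1. fps_X ^ j) * C k [k * i]" .
    let ?R = "if i = 0 then 1 else fps_X * C k [k * i - 1]"
    have "C k [k * i] = (\<Sum>j=1..k - 1. fps_X ^ j) * C k [k * i] + ?R"
      using C_dvd[OF k, of i] unfolding S .
    then have "?D * C k [k * i] = ?R"
      unfolding left_diff_distrib mult_1_left diff_eq_eq by (rule trans[OF _ add.commute])
    then have "H (k - 1) * ?D * C k [k * i] = H (k - 1) * ?R"
      by (simp only: mult.assoc)
    then show ?thesis
      by (simp only: HD mult_1_left)
  qed
  show ?thesis
  proof (induction i)
    case 0
    show ?case using step[of 0] by simp
  next
    case (Suc i)
    \<comment> \<open>The predecessor of \<open>k * Suc i\<close> is the top letter of block
      \<open>i\<close>, so \<open>C_add\<close> contributes \<open>k - 1\<close> factors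
      \<open>fps_X\<close> and \<open>step\<close> one more.\<close>
    have "k * Suc i - 1 = k * i + (k - 1)"
      using k by simp
    then have "C k [k * Suc i] = H (k - 1) * (fps_X * (fps_X ^ (k - 1) * C k [k * i]))"
      using step[of "Suc i"] C_add[OF k, of "k - 1" i] k by simp
    also have "\<dots> = fps_X ^ k * H (k - 1) * C k [k * i]"
      using k power_Suc[of "fps_X :: rat fps" "k - 1"] by (simp add: ac_simps)
    finally show ?case
      unfolding Suc by (simp add: power_add ac_simps)
  qed
qed

theorem theorem5p7:
  fixes k i b :: nat and B :: "nat list"
  assumes "k \<ge> 3"
    and "1 \<le> b" and "b \<le> k - 1"
    and "B = (k * i) \<oplus> [0, b]"
  shows "B = [k * i, k * i + b] \<and>
         C k B = C k [b + k * i] \<and>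
         C k [b + k * i] = fps_X ^ (b + k * i) * H (k - 1) ^ (i + 1)"
proof -
  have B: "B = [k * i, k * i + b]"
    using assms(4) by (simp add: shift_word_def)
  have "C k [b + k * i] = fps_X ^ (b + k * i) * H (k - 1) ^ (i + 1)"
    using C_add[of k b i] C_multiple[of k i] assms
    by (simp add: power_add ac_simps)
  moreover have "C k B = C k [b + k * i]"
    using C_pair[of k b i] assms by (simp add: B add.commute)
  ultimately show ?thesis
    using B by blast
qed

end
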